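(* Let $(\mathcal{M},d)$ be a metric space with $d(x,y)\in[1,\Delta]$ for all distinct $x,y\in\mathcal{M}$, let $K\in\mathbb{N}$ and $\varepsilon>0$. There is a deterministic expiration-streaming algorithm that stores $\mathcal{O}((K^2/\varepsilon)\log\Delta)$ words and maintains, for every $k\le K$, a $(6k+2)(1+\varepsilon)$-approximate solution for $k$-center on the active items: at any query time $t$ and for any $k\le K$ it can output a set $C\subseteq\mathcal{M}$ with $|C|\le k$ such that $\max_{x\in X_t}d(x,C)\le(6k+2)(1+\varepsilon)\,\mathrm{OPT}_k(X_t)$, where $X_t$ is the set of items active at time $t$.
   Context: Expiration streaming model: the input is a sequence of items $x_1,\dots,x_n$; each item $x$ consists of a point $p(x)\in\mathcal{M}$, an integer insertion time $S(x)>0$ and an expiration time $E(x)>S(x)$ (possibly $\infty$), with $S(x_1)\le\dots\le S(x_n)$. An item $x$ is active at time $t$ if $S(x)\le t<E(x)$; queries at arbitrary times (unknown in advance) are evaluated on the active items. Space is measured in words, where a word stores a point, a time value, or a counter in $[\mathrm{poly}(n)]$. For a finite set $X\subseteq\mathcal{M}$, $d(x,C)=\min_{c\in C}d(x,c)$ and $\mathrm{OPT}_k(X)=\min_{C\subset\mathcal{M},|C|=k}\max_{x\in X}d(x,C)$.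
   Formalization: The space bound is proved as O(max(K², (K²/min(1,ε)) log Δ)) words: the literal O((K²/ε) log Δ) fails for Δ = 1 (it gives 0 words, yet a point must be stored) and for large ε; for ε ≤ 1 and log Δ ≥ ε the two agree. *)

theory Defs
  imports
    "HOL-Analysis.Analysis"
    "HOL-Computational_Algebra.Polynomial"
begin

text \<open>The selectors are \<open>p(x)\<close>, \<open>S(x)\<close> and \<open>E(x)\<close>; expiration times are arbitrary extended
  reals, not only integers.\<close>

datatype 'a item = Item (pt: 'a) (ins: nat) (expiry: ereal)

definition valid_stream :: "'a set \<Rightarrow> 'a item list \<Rightarrow> bool" where
  "valid_stream M xs \<longleftrightarrow>
     (\<forall>x\<in>set xs. pt x \<in> M \<and> 0 < ins x \<and> ereal (real (ins x)) < expiry x) \<and>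
     sorted (map ins xs)"

definition arrived :: "'a item list \<Rightarrow> real \<Rightarrow> 'a item list" where
  "arrived xs t = filter (\<lambda>x. real (ins x) \<le> t) xs"

text \<open>The active items at time \<open>t\<close> enter the \<open>k\<close>-center objective only through their points.\<close>

definition active :: "'a item list \<Rightarrow> real \<Rightarrow> 'a set" where
  "active xs t = pt ` {x \<in> set xs. real (ins x) \<le> t \<and> ereal t < expiry x}"

datatype 'a word = Point 'a | Time ereal | Counter nat

text \<open>The whole memory is a list of words, so all information kept between arrivals is paid for.
  Answering a query reads the memory, \<open>k\<close> and the current time, and does not modify the memory.\<close>

record 'a streaming_algorithm =
  init :: "'a word list"
  step :: "'a word list \<Rightarrow> 'a item \<Rightarrow> 'a word list"
  answer :: "'a word list \<Rightarrow> nat \<Rightarrow> real \<Rightarrow> 'a set"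

definition run :: "'a streaming_algorithm \<Rightarrow> 'a item list \<Rightarrow> 'a word list" where
  "run A xs = foldl (step A) (init A) xs"

text \<open>Contents a word may have once the stream \<open>xs\<close> of length \<open>n\<close> has been read: a point or a time
  value occurring in \<open>xs\<close>, or a counter at most \<open>q(n)\<close>. Admitting arbitrary points of an infinite
  space, or arbitrary real times, would allow an entire stream to be encoded in one word.\<close>

fun word_ok :: "nat poly \<Rightarrow> 'a item list \<Rightarrow> 'a word \<Rightarrow> bool" where
  "word_ok q xs (Point y) \<longleftrightarrow> y \<in> pt ` set xs"
| "word_ok q xs (Time s) \<longleftrightarrow> s \<in> (\<lambda>x. ereal (real (ins x))) ` set xs \<union> expiry ` set xs"
| "word_ok q xs (Counter m) \<longleftrightarrow> m \<le> poly q (length xs)"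

text \<open>For \<open>\<epsilon> \<le> 1\<close> and \<open>log \<Delta> \<ge> \<epsilon>\<close> this is exactly \<open>(K\<^sup>2/\<epsilon>) log \<Delta>\<close>. The guards only concern
  large \<open>\<epsilon>\<close> and \<open>\<Delta>\<close> near 1, where that expression tends to 0 although up to \<open>K\<close> distinct points
  have to be remembered.\<close>

definition space_bound :: "nat \<Rightarrow> real \<Rightarrow> real \<Rightarrow> real" where
  "space_bound K \<epsilon> \<Delta> = max (real K ^ 2) (real K ^ 2 / min 1 \<epsilon> * log 2 \<Delta>)"

text \<open>Values are in \<open>ennreal\<close>: the distance to the empty set is \<open>\<infinity>\<close> and the maximum over an empty
  set of points is 0.\<close>

definition set_dist :: "('a \<Rightarrow> 'a \<Rightarrow> real) \<Rightarrow> 'a \<Rightarrow> 'a set \<Rightarrow> ennreal" where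
  "set_dist d x C = (INF c\<in>C. ennreal (d x c))"

definition cost :: "('a \<Rightarrow> 'a \<Rightarrow> real) \<Rightarrow> 'a set \<Rightarrow> 'a set \<Rightarrow> ennreal" where
  "cost d X C = (SUP x\<in>X. set_dist d x C)"

text \<open>If \<open>M\<close> has fewer than \<open>k\<close> points there is no \<open>C \<subseteq> M\<close> of size \<open>k\<close>; then \<open>C = M\<close> is used.
  An infimum is taken since the minimum need not be attained when \<open>M\<close> is infinite.\<close>

definition opt :: "'a set \<Rightarrow> ('a \<Rightarrow> 'a \<Rightarrow> real) \<Rightarrow> nat \<Rightarrow> 'a set \<Rightarrow> ennreal" where
  "opt M d k X =
     (INF C\<in>{C. C \<subseteq> M \<and> finite C \<and> (card C = k \<or> C = M \<and> card M < k)}. cost d X C)"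

end

theory Submission imports Defs begin

text \<open>For each \<open>k \<le> K\<close> and each scale \<open>s\<close> among \<open>0, 1, b, b\<^sup>2, \<dots>\<close> with \<open>b = 1 + min 1 \<epsilon>\<close>, keep at
  most \<open>k\<close> pairs (point, expiration time) whose points are more than \<open>s\<close> apart. A new pair is
  ignored if a kept pair within distance \<open>s\<close> expires no earlier; otherwise it replaces all kept
  pairs within distance \<open>s\<close>. On overflow the earliest expiring pairs are dropped and their
  expiration time \<open>T\<close> is recorded: at every time before \<open>T\<close> there are \<open>k + 1\<close> active points at
  distances greater than \<open>s\<close>, so \<open>OPT\<^sub>k \<ge> s / 2\<close>. From time \<open>T\<close> on, every active point is joined to a
  kept one by a chain of points with steps of length at most \<open>s\<close> and nondecreasing expiration times.
  The chain therefore consists of active points, and as these lie in \<open>k\<close> balls of radius \<open>\<rho>\<close>, its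
  ends are at distance at most \<open>k (2 \<rho> + s)\<close>. A query uses the least scale whose \<open>T\<close> has passed;
  there \<open>s \<le> 2 b OPT\<^sub>k\<close>, because the threshold below is still certified.\<close>

section \<open>Chains through few balls\<close>

text \<open>Cut the path at its last vertex in \<open>P\<close>; what follows avoids
  \<open>P\<close>. This lets a whole ball be removed at once when inducting on the number of
  balls.\<close>

lemma rtrancl_last_exit:
  assumes "(x, y) \<in> R\<^sup>*" "x \<in> P"
  shows "\<exists>z\<in>P. z = y \<or> (\<exists>w. (z, w) \<in> R \<and> w \<notin> P \<and> (w, y) \<in> (R \<inter> (- P) \<times> (- P))\<^sup>*)"
  using assms
proof (induction rule: rtrancl_induct)
  case base
  then show ?case by blast
next
  case (step y y')
  show ?case
  proof (cases "y' \<in> P")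
    case False
    from step obtain z where z: "z \<in> P"
      "z = y \<or> (\<exists>w. (z, w) \<in> R \<and> w \<notin> P \<and> (w, y) \<in> (R \<inter> (- P) \<times> (- P))\<^sup>*)" by blast
    show ?thesis
    proof (cases "z = y")
      case True
      then show ?thesis using z False step.hyps by blast
    next
      case neq: False
      then obtain w where w: "(z, w) \<in> R" "w \<notin> P" "(w, y) \<in> (R \<inter> (- P) \<times> (- P))\<^sup>*"
        using z by blast
      have "y \<notin> P"
        using w(3,2) by (induction rule: rtrancl_induct) auto
      then have "(w, y') \<in> (R \<inter> (- P) \<times> (- P))\<^sup>*"
        using False step.hyps by (intro rtrancl.rtrancl_into_rtrancl[OF w(3)]) simp
      then show ?thesis using z w by blast
    qed
  qed blast
qed

context Metric_space
begin

text \<open>Each ball is charged only once. In the ball around a center near \<open>x\<close>, the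
  last chain point is within \<open>2 * \<rho>\<close> of \<open>x\<close>. Unless the chain ends
  there, one step of length at most \<open>s\<close> leaves the ball for good, and the rest is
  covered by the other centers.\<close>

lemma chain_dist_le:
  assumes "finite C" "C \<subseteq> M" "V \<subseteq> M" "0 \<le> s"
    and "\<And>v. v \<in> V \<Longrightarrow> \<exists>c\<in>C. d v c \<le> \<rho>"
    and "(x, y) \<in> {(a, b) \<in> V \<times> V. d a b \<le> s}\<^sup>*" "x \<in> V"
  shows "d x y \<le> real (card C) * (2 * \<rho> + s)"
  using assms
proof (induction "card C" arbitrary: C V x)
  case 0
  then show ?case by fastforce
next
  case (Suc n)
  obtain c where c: "c \<in> C" "d x c \<le> \<rho>" using Suc.prems by blast
  define P where "P = {v. d v c \<le> \<rho>}"
  let ?R = "{(a, b) \<in> V \<times> V. d a b \<le> s}"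
  have R: "?R \<inter> (- P) \<times> (- P) = {(a, b) \<in> (V - P) \<times> (V - P). d a b \<le> s}" by auto
  have \<rho>: "0 \<le> \<rho>" using c nonneg[of x c] by linarith
  have card: "real (card C) = real n + 1" using Suc.hyps(2) by simp
  have yV: "y \<in> V" using Suc.prems(6,7) by (induction rule: rtrancl_induct) auto
  have near: "d x v \<le> 2 * \<rho>" if "v \<in> P" "v \<in> V" for v
  proof -
    have "d x v \<le> d x c + d c v"
      using triangle[of x c v] Suc.prems c that by blast
    also have "d c v = d v c" by (rule commute)
    finally show ?thesis using c that by (simp add: P_def)
  qed
  obtain z where z: "z \<in> P" "z = y \<or> (\<exists>w. (z, w) \<in> ?R \<and> w \<notin> P \<and>
      (w, y) \<in> {(a, b) \<in> (V - P) \<times> (V - P). d a b \<le> s}\<^sup>*)"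
    using rtrancl_last_exit[OF Suc.prems(6), of P] c unfolding R by (auto simp: P_def)
  show ?case
  proof (cases "z = y")
    case True
    have "0 \<le> real n * (2 * \<rho> + s)" using \<rho> Suc.prems by simp
    then show ?thesis using near[of y] z True yV Suc.prems card by (simp add: algebra_simps)
  next
    case False
    then obtain w where w: "(z, w) \<in> ?R" "w \<notin> P"
      "(w, y) \<in> {(a, b) \<in> (V - P) \<times> (V - P). d a b \<le> s}\<^sup>*" using z by blast
    have "d w y \<le> real (card (C - {c})) * (2 * \<rho> + s)"
    proof (rule Suc.hyps(1)[of "C - {c}" "V - P" w])
      show "\<exists>c'\<in>C - {c}. d v c' \<le> \<rho>" if "v \<in> V - P" for v
        using Suc.prems(5)[of v] that by (auto simp: P_def)
    qed (use Suc.prems Suc.hyps(2) w c in auto)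
    moreover have "x \<in> M" "y \<in> M" "z \<in> M" "w \<in> M" using Suc.prems w yV by auto
    then have "d x y \<le> d x z + d z w + d w y"
      using triangle[of x z w] triangle[of x w y] by simp
    moreover have "d x z \<le> 2 * \<rho>" "d z w \<le> s" using near z w by auto
    moreover have "card (C - {c}) = n" using c Suc.prems Suc.hyps(2) by simp
    ultimately show ?thesis using card by (simp add: algebra_simps)
  qed
qed

end

section \<open>The sketch at one scale\<close>

type_synonym 'a sketch = "ereal \<times> ('a \<times> ereal) list"

definition insert_pair ::
    "('a \<Rightarrow> 'a \<Rightarrow> real) \<Rightarrow> real \<Rightarrow> 'a \<times> ereal \<Rightarrow> ('a \<times> ereal) list \<Rightarrow> ('a \<times> ereal) list" where
  "insert_pair d s a L =
     (if \<exists>b\<in>set L. d (fst a) (fst b) \<le> s \<and> snd a \<le> snd b then L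
      else filter (\<lambda>b. s < d (fst a) (fst b)) L @ [a])"

text \<open>The maximum is needed because a pair inserted after an earlier overflow may expire
  before \<open>T\<close>.\<close>

definition trim :: "nat \<Rightarrow> 'a sketch \<Rightarrow> 'a sketch" where
  "trim k Q = (case Q of (T, L) \<Rightarrow>
     if length L \<le> k then (T, L)
     else let m = Min (snd ` set L) in (max T m, filter (\<lambda>b. m < snd b) L))"

definition update :: "('a \<Rightarrow> 'a \<Rightarrow> real) \<Rightarrow> real \<Rightarrow> nat \<Rightarrow> 'a sketch \<Rightarrow> 'a \<times> ereal \<Rightarrow> 'a sketch" where
  "update d s k Q a = trim k (fst Q, insert_pair d s a (snd Q))"

definition link ::
    "('a \<Rightarrow> 'a \<Rightarrow> real) \<Rightarrow> real \<Rightarrow> ('a \<times> ereal) set \<Rightarrow> (('a \<times> ereal) \<times> ('a \<times> ereal)) set" where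
  "link d s S = {(a, b) \<in> S \<times> S. d (fst a) (fst b) \<le> s \<and> snd a \<le> snd b}"

abbreviation separated :: "('a \<Rightarrow> 'a \<Rightarrow> real) \<Rightarrow> real \<Rightarrow> ('a \<times> ereal) list \<Rightarrow> bool" where
  "separated d s \<equiv> sorted_wrt (\<lambda>a b. s < d (fst a) (fst b))"

text \<open>\<open>S\<close> holds all pairs read so far. Membership of \<open>T\<close> among their
  expiration times serves the word contents, the coverage clause excuses pairs that expire by
  \<open>T\<close>, and \<open>W\<close> is the lower-bound certificate left by an overflow.\<close>

definition sound ::
    "('a \<Rightarrow> 'a \<Rightarrow> real) \<Rightarrow> real \<Rightarrow> nat \<Rightarrow> ('a \<times> ereal) set \<Rightarrow> 'a sketch \<Rightarrow> bool" where
  "sound d s k S Q \<longleftrightarrow> (case Q of (T, L) \<Rightarrow>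
     set L \<subseteq> S \<and> separated d s L \<and> (T = -\<infinity> \<or> T \<in> snd ` S) \<and>
     (\<forall>a\<in>S. snd a \<le> T \<or> (\<exists>b\<in>set L. (a, b) \<in> (link d s S)\<^sup>*)) \<and>
     (T = -\<infinity> \<or> (\<exists>W. length W = Suc k \<and> set W \<subseteq> S \<and> separated d s W \<and> (\<forall>b\<in>set W. T \<le> snd b))))"

lemma link_mono: "S \<subseteq> S' \<Longrightarrow> (link d s S)\<^sup>* \<subseteq> (link d s S')\<^sup>*"
  by (rule rtrancl_mono) (auto simp: link_def)

lemma link_snd_le: "(a, b) \<in> (link d s S)\<^sup>* \<Longrightarrow> snd a \<le> snd b"
  by (induction rule: rtrancl_induct) (auto simp: link_def intro: order_trans)

lemma length_insert_pair: "length (insert_pair d s a L) \<le> Suc (length L)"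
  by (simp add: insert_pair_def)

lemma length_trim:
  assumes "length (snd Q) \<le> Suc k"
  shows "length (snd (trim k Q)) \<le> k"
proof (cases "length (snd Q) \<le> k")
  case False
  let ?m = "Min (snd ` set (snd Q))"
  have "snd ` set (snd Q) \<noteq> {}" using False by auto
  then have "?m \<in> snd ` set (snd Q)" by (intro Min_in) auto
  then obtain b where "b \<in> set (snd Q)" "?m = snd b" by auto
  then have "length (filter (\<lambda>b. ?m < snd b) (snd Q)) < length (snd Q)"
    by (intro length_filter_less) auto
  then show ?thesis using assms False by (auto simp: trim_def Let_def split: prod.splits)
qed (auto simp: trim_def split: prod.splits)

lemma length_update:
  "length (snd Q) \<le> k \<Longrightarrow> length (snd (update d s k Q a)) \<le> k"
  unfolding update_def using length_insert_pair[of d s a "snd Q"] by (intro length_trim) simp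

lemma sound_insert_pair:
  assumes "sound d s k S (T, L)" and sym: "\<And>x y. d x y = d y x"
  shows "sound d s k (insert a S) (T, insert_pair d s a L)"
proof -
  let ?L = "insert_pair d s a L" and ?S = "insert a S"
  have old: "set L \<subseteq> S" "separated d s L" "T = -\<infinity> \<or> T \<in> snd ` S"
    "\<And>a. a \<in> S \<Longrightarrow> snd a \<le> T \<or> (\<exists>b\<in>set L. (a, b) \<in> (link d s S)\<^sup>*)"
    "T = -\<infinity> \<or> (\<exists>W. length W = Suc k \<and> set W \<subseteq> S \<and> separated d s W \<and> (\<forall>b\<in>set W. T \<le> snd b))"
    using assms(1) unfolding sound_def by auto
  have L: "set ?L \<subseteq> ?S" using old(1) by (auto simp: insert_pair_def)
  have sep: "separated d s ?L"
    using old(2) by (auto simp: insert_pair_def sorted_wrt_append sorted_wrt_filter sym)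
  have new: "\<exists>b'\<in>set ?L. (b, b') \<in> (link d s ?S)\<^sup>*" if b: "b \<in> insert a (set L)" for b
  proof (cases "b \<in> set ?L")
    case False
    show ?thesis
    proof (cases "\<exists>b\<in>set L. d (fst a) (fst b) \<le> s \<and> snd a \<le> snd b")
      case True
      then obtain b' where b': "b' \<in> set L" "d (fst a) (fst b') \<le> s" "snd a \<le> snd b'" by blast
      from True False b have "b = a" "?L = L" by (auto simp: insert_pair_def)
      then show ?thesis using b' old(1) by (auto simp: link_def)
    next
      case far: False
      then have eq: "?L = filter (\<lambda>b. s < d (fst a) (fst b)) L @ [a]"
        by (simp only: insert_pair_def if_False)
      have bL: "b \<in> set L" "d (fst a) (fst b) \<le> s" using False b by (auto simp: eq)
      then have "snd b \<le> snd a" using far by force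
      then have "(b, a) \<in> link d s ?S" using bL old(1) sym[of "fst a"] by (auto simp: link_def)
      then show ?thesis by (auto simp: eq)
    qed
  qed auto
  have cov: "snd c \<le> T \<or> (\<exists>b\<in>set ?L. (c, b) \<in> (link d s ?S)\<^sup>*)" if "c \<in> ?S" for c
  proof (cases "c = a")
    case False
    with that old(4)[of c] consider "snd c \<le> T" | b where "b \<in> set L" "(c, b) \<in> (link d s S)\<^sup>*"
      by auto
    then show ?thesis
    proof cases
      case 2
      with new[of b] obtain b' where b': "b' \<in> set ?L" "(b, b') \<in> (link d s ?S)\<^sup>*" by auto
      have "(c, b) \<in> (link d s ?S)\<^sup>*" using 2 link_mono[of S ?S] by blast
      then show ?thesis using b' by (meson rtrancl_trans)
    qed simp
  qed (use new in simp)
  show ?thesis using L sep cov old(3,5) unfolding sound_def by fast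
qed

text \<open>The overflowing list itself consists of \<open>k + 1\<close> separated pairs expiring no
  earlier than \<open>m\<close>, so it certifies \<open>m\<close>; if \<open>T\<close> is larger,
  the old certificate stays. A pair whose representative is dropped expires by \<open>m\<close>,
  because expiration times do not decrease along links.\<close>

lemma sound_trim:
  assumes "sound d s k S Q" and len: "length (snd Q) \<le> Suc k"
  shows "sound d s k S (trim k Q)"
proof (cases "length (snd Q) \<le> k")
  case False
  obtain T L where Q: "Q = (T, L)" by (cases Q)
  define m where "m = Min (snd ` set L)"
  have "snd ` set L \<noteq> {}" using False Q by auto
  then have m: "m \<in> snd ` set L" "\<And>b. b \<in> set L \<Longrightarrow> m \<le> snd b"
    unfolding m_def by (auto intro: Min_in)
  have old: "set L \<subseteq> S" "separated d s L" "T = -\<infinity> \<or> T \<in> snd ` S"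
    "\<And>a. a \<in> S \<Longrightarrow> snd a \<le> T \<or> (\<exists>b\<in>set L. (a, b) \<in> (link d s S)\<^sup>*)"
    "T = -\<infinity> \<or> (\<exists>W. length W = Suc k \<and> set W \<subseteq> S \<and> separated d s W \<and> (\<forall>b\<in>set W. T \<le> snd b))"
    using assms(1) unfolding sound_def Q by auto
  have trim: "trim k Q = (max T m, filter (\<lambda>b. m < snd b) L)"
    using False by (simp add: trim_def Q m_def Let_def)
  have "max T m = -\<infinity> \<or> max T m \<in> snd ` S" using m(1) old(1,3) by (auto simp: max_def)
  moreover have "max T m = -\<infinity> \<or> (\<exists>W. length W = Suc k \<and> set W \<subseteq> S \<and> separated d s W \<and>
      (\<forall>b\<in>set W. max T m \<le> snd b))"
  proof (cases "T \<le> m")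
    case True
    have "length L = Suc k" using len False Q by simp
    then show ?thesis using True m(2) old(1,2) by (intro disjI2 exI[of _ L]) (auto simp: max_def)
  next
    case False
    then have "max T m = T" by (simp add: max_def)
    then show ?thesis using old(5) by simp
  qed
  moreover have "snd a \<le> max T m \<or> (\<exists>b\<in>set (filter (\<lambda>b. m < snd b) L). (a, b) \<in> (link d s S)\<^sup>*)"
    if a: "a \<in> S" for a
  proof -
    consider "snd a \<le> T" | b where "b \<in> set L" "(a, b) \<in> (link d s S)\<^sup>*" using old(4)[OF a] by auto
    then show ?thesis
    proof cases
      case 1
      then show ?thesis by (simp add: max.coboundedI1)
    next
      case 2
      show ?thesis
      proof (cases "m < snd b")
        case True
        then have "b \<in> set (filter (\<lambda>b. m < snd b) L)" using 2 by simp
        then show ?thesis using 2 by blast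
      next
        case False
        then have "snd a \<le> m" using link_snd_le[OF 2(2)] by simp
        then show ?thesis by (simp add: max.coboundedI2)
      qed
    qed
  qed
  ultimately show ?thesis
    using old(1,2) unfolding sound_def trim by (auto simp: sorted_wrt_filter)
qed (use assms in \<open>auto simp: trim_def split: prod.splits\<close>)

lemma sound_foldl_update:
  assumes "\<And>x y. d x y = d y x"
  shows "sound d s k (set as) (foldl (update d s k) (-\<infinity>, []) as) \<and>
    length (snd (foldl (update d s k) (-\<infinity>, []) as)) \<le> k"
proof (induction as rule: rev_induct)
  case Nil
  then show ?case by (simp add: sound_def)
next
  case (snoc a as)
  let ?Q = "foldl (update d s k) (-\<infinity>, []) as"
  have "sound d s k (insert a (set as)) (fst ?Q, insert_pair d s a (snd ?Q))"
    using snoc assms by (intro sound_insert_pair) auto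
  then have "sound d s k (insert a (set as)) (update d s k ?Q a)"
    unfolding update_def[of d s k ?Q a]
    using snoc length_insert_pair[of d s a "snd ?Q"] by (intro sound_trim) auto
  then show ?case using snoc length_update[of ?Q k d s a] by simp
qed

section \<open>Upper and lower bounds on distances drawn from a sound sketch\<close>

context Metric_space
begin

text \<open>An active pair is not excused by \<open>T\<close>, so a chain leads from it to a kept
  pair. All pairs on the chain expire no earlier, hence their points lie in the balls and the chain
  bound applies.\<close>

lemma sound_covers:
  assumes "sound d s k S (T, L)" "fst ` S \<subseteq> M" "0 \<le> s"
    and C: "finite C" "C \<subseteq> M" "card C \<le> k"
    and \<rho>: "\<And>a. a \<in> S \<Longrightarrow> ereal t < snd a \<Longrightarrow> \<exists>c\<in>C. d (fst a) c \<le> \<rho>"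
    and T: "T \<le> ereal t" and a: "a \<in> S" "ereal t < snd a"
  shows "\<exists>b\<in>set L. d (fst a) (fst b) \<le> real k * (2 * \<rho> + s)"
proof -
  have "\<not> snd a \<le> T" using T a(2) by auto
  then obtain b where b: "b \<in> set L" "(a, b) \<in> (link d s S)\<^sup>*"
    using assms(1) a(1) by (fastforce simp: sound_def)
  define V where "V = fst ` {a \<in> S. ereal t < snd a}"
  have "(fst a, fst b) \<in> {(x, y) \<in> V \<times> V. d x y \<le> s}\<^sup>*"
    using b(2)
  proof (induction rule: rtrancl_induct)
    case (step b c)
    have "ereal t < snd b" using link_snd_le[OF step.hyps(1)] a(2) by simp
    then have "(fst b, fst c) \<in> {(x, y) \<in> V \<times> V. d x y \<le> s}"
      using step.hyps(2) by (auto simp: V_def link_def)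
    then show ?case by (rule rtrancl.rtrancl_into_rtrancl[OF step.IH])
  qed simp
  then have "d (fst a) (fst b) \<le> real (card C) * (2 * \<rho> + s)"
    by (rule chain_dist_le[rotated 5]) (use assms a in \<open>auto simp: V_def\<close>)
  \<comment> \<open>Replacing \<open>card C\<close> by \<open>k\<close> needs
    \<open>0 \<le> \<rho>\<close>, which holds because the point of \<open>a\<close> itself lies in
    a ball.\<close>
  also have "\<dots> \<le> real k * (2 * \<rho> + s)"
  proof -
    obtain c where "d (fst a) c \<le> \<rho>" using \<rho>[OF a] by blast
    then have "0 \<le> \<rho>" using nonneg[of "fst a" c] by linarith
    then show ?thesis using assms by (intro mult_right_mono) auto
  qed
  finally show ?thesis using b by blast
qed

text \<open>Two of the \<open>k + 1\<close> points share a center. Distinctness is recorded so that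
  the minimum distance 1 later yields \<open>1 \<le> 2 * \<rho>\<close>.\<close>

lemma separated_pigeonhole:
  assumes "separated d s W" "length W = Suc k" "fst ` set W \<subseteq> M" "0 \<le> s"
    and C: "finite C" "C \<subseteq> M" "card C \<le> k"
    and "\<And>a. a \<in> set W \<Longrightarrow> \<exists>c\<in>C. d (fst a) c \<le> \<rho>"
  obtains x y where "x \<in> M" "y \<in> M" "x \<noteq> y" "s < d x y" "d x y \<le> 2 * \<rho>"
proof -
  obtain g where g: "\<And>a. a \<in> set W \<Longrightarrow> g a \<in> C \<and> d (fst a) (g a) \<le> \<rho>" using assms(8) by metis
  have "W ! i \<in> set W" if "i < Suc k" for i using assms(2) that by simp
  then have "(\<lambda>i. g (W ! i)) ` {..<Suc k} \<subseteq> C" using g by blast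
  then have "card ((\<lambda>i. g (W ! i)) ` {..<Suc k}) < card {..<Suc k}"
    using C by (metis card_lessThan card_mono le_imp_less_Suc order_trans)
  then have "\<not> inj_on (\<lambda>i. g (W ! i)) {..<Suc k}" by (rule pigeonhole)
  then obtain i j where ij: "i < j" "j < Suc k" "g (W ! i) = g (W ! j)"
    using linorder_inj_onI'[of "{..<Suc k}" "\<lambda>i. g (W ! i)"] by auto
  let ?x = "fst (W ! i)" and ?y = "fst (W ! j)"
  have W: "W ! i \<in> set W" "W ! j \<in> set W" using ij assms(2) by auto
  then have M: "?x \<in> M" "?y \<in> M" "g (W ! i) \<in> M" using assms(3) g[OF W(1)] C by auto
  have far: "s < d ?x ?y" using sorted_wrt_nth_less[OF assms(1)] ij assms(2) by simp
  have "d ?x ?y \<le> d ?x (g (W ! i)) + d (g (W ! i)) ?y" using M triangle by blast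
  also have "\<dots> \<le> \<rho> + \<rho>"
    using g[OF W(1)] g[OF W(2)] ij(3) commute[of "g (W ! i)" ?y] by simp
  finally have "d ?x ?y \<le> 2 * \<rho>" by simp
  moreover have "?x \<noteq> ?y" using far assms(4) zero[OF M(1,2)] by linarith
  ultimately show ?thesis using that M far by blast
qed

end

section \<open>Encoding sketches as words\<close>

text \<open>The initial value \<open>-\<infinity>\<close> of \<open>T\<close> does not occur in the stream and is stored as a counter; the
  word for \<open>T\<close> follows the pairs and terminates the sketch.\<close>

definition encode_sketch :: "'a sketch \<Rightarrow> 'a word list" where
  "encode_sketch Q = concat (map (\<lambda>a. [Point (fst a), Time (snd a)]) (snd Q)) @
     [if fst Q = -\<infinity> then Counter 0 else Time (fst Q)]"

definition encode :: "'a sketch list \<Rightarrow> 'a word list" where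
  "encode Qs = concat (map encode_sketch Qs)"

text \<open>A \<open>Time\<close> right after a \<open>Point\<close> completes a pair, any other
  \<open>Time\<close> is a terminator, so parsing is unambiguous. The \<open>[]\<close> branch is a
  default that no encoded memory reaches.\<close>

fun decode :: "'a word list \<Rightarrow> 'a sketch list" where
  "decode (Point x # Time e # ws) =
     (case decode ws of [] \<Rightarrow> [] | (T, L) # Qs \<Rightarrow> (T, (x, e) # L) # Qs)"
| "decode (Time T # ws) = (T, []) # decode ws"
| "decode (Counter c # ws) = (-\<infinity>, []) # decode ws"
| "decode ws = []"

lemma decode_encode_sketch: "decode (encode_sketch (T, L) @ ws) = (T, L) # decode ws"
  by (induction L) (auto simp: encode_sketch_def)

lemma decode_encode: "decode (encode Qs) = Qs"
  by (induction Qs) (auto simp: encode_def decode_encode_sketch)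

lemma length_encode_sketch: "length (encode_sketch Q) = 2 * length (snd Q) + 1"
proof -
  have "length (concat (map (\<lambda>a. [Point (fst a), Time (snd a)]) L)) = 2 * length L"
    for L :: "('a \<times> ereal) list"
    by (induction L) auto
  then show ?thesis by (simp add: encode_sketch_def)
qed

lemma length_encode_le:
  assumes "\<And>Q. Q \<in> set Qs \<Longrightarrow> length (snd Q) \<le> K"
  shows "length (encode Qs) \<le> length Qs * (2 * K + 1)"
  using assms
proof (induction Qs)
  case (Cons Q Qs)
  have "length (encode Qs) \<le> length Qs * (2 * K + 1)" using Cons by simp
  moreover have "length (snd Q) \<le> K" using Cons.prems by simp
  ultimately show ?case by (simp add: encode_def length_encode_sketch)
qed (simp add: encode_def)

section \<open>The algorithm\<close>

text \<open>Scale 0 serves the case of optimum 0, where no positive step length is affordable. The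
  powers start at 1, the lower bound on distances between distinct points.\<close>

definition threshold :: "real \<Rightarrow> nat \<Rightarrow> real" where
  "threshold b i = (if i = 0 then 0 else b ^ (i - 1))"

text \<open>\<open>k\<close> starts at 1: for \<open>k = 0\<close> the answer is the empty set and
  nothing is stored.\<close>

definition indices :: "nat \<Rightarrow> nat \<Rightarrow> (nat \<times> nat) list" where
  "indices N K = List.product [0..<Suc N] [1..<Suc K]"

lemma in_set_indices: "(i, k) \<in> set (indices N K) \<longleftrightarrow> i \<le> N \<and> 1 \<le> k \<and> k \<le> K"
  by (auto simp: indices_def simp del: upt_Suc)

lemma length_indices: "length (indices N K) = Suc N * K"
  by (simp add: indices_def length_product del: upt_Suc)

definition kcenter_algorithm ::
    "('a \<Rightarrow> 'a \<Rightarrow> real) \<Rightarrow> real \<Rightarrow> nat \<Rightarrow> nat \<Rightarrow> 'a streaming_algorithm" where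
  "kcenter_algorithm d b N K =
     \<lparr>init = encode (map (\<lambda>_. (-\<infinity>, [])) (indices N K)),
      step = (\<lambda>ws x. encode (map2 (\<lambda>(i, k) Q. update d (threshold b i) k Q (pt x, expiry x))
                (indices N K) (decode ws))),
      answer = (\<lambda>ws k t. if k = 0 then {} else
         let sketch = (\<lambda>i. the (map_of (zip (indices N K) (decode ws)) (i, k)))
         in fst ` set (snd (sketch (LEAST i. fst (sketch i) \<le> ereal t))))\<rparr>"

abbreviation pairs :: "'a item list \<Rightarrow> ('a \<times> ereal) list" where
  "pairs \<equiv> map (\<lambda>x. (pt x, expiry x))"

definition sketch_of ::
    "('a \<Rightarrow> 'a \<Rightarrow> real) \<Rightarrow> real \<Rightarrow> 'a item list \<Rightarrow> nat \<times> nat \<Rightarrow> 'a sketch" where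
  "sketch_of d b xs = (\<lambda>(i, k). foldl (update d (threshold b i) k) (-\<infinity>, []) (pairs xs))"

lemma run_kcenter_algorithm:
  "run (kcenter_algorithm d b N K) xs = encode (map (sketch_of d b xs) (indices N K))"
proof (induction xs rule: rev_induct)
  case Nil
  show ?case by (auto simp: run_def kcenter_algorithm_def sketch_of_def intro!: arg_cong[where f = encode])
next
  case (snoc x xs)
  have map2: "map2 f js (map g js) = map (\<lambda>j. f j (g j)) js"
    for f :: "nat \<times> nat \<Rightarrow> 'a sketch \<Rightarrow> 'a sketch" and g js
    by (induction js) auto
  have "run (kcenter_algorithm d b N K) (xs @ [x]) =
      step (kcenter_algorithm d b N K) (encode (map (sketch_of d b xs) (indices N K))) x"
    using snoc by (simp add: run_def)
  also have "\<dots> = encode (map (sketch_of d b (xs @ [x])) (indices N K))"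
    by (auto simp: kcenter_algorithm_def decode_encode map2 sketch_of_def
        intro!: arg_cong[where f = encode])
  finally show ?case .
qed

text \<open>The least index is sought among all naturals, with unspecified values outside the grid.
  The index \<open>i\<close> forces it into the grid, where the lookup returns the intended
  sketch.\<close>

lemma answer_kcenter_algorithm:
  assumes "1 \<le> k" "k \<le> K"
    and ex: "i \<le> N" "fst (sketch_of d b xs (i, k)) \<le> ereal t"
  obtains j where "fst (sketch_of d b xs (j, k)) \<le> ereal t"
    "\<And>i. i < j \<Longrightarrow> ereal t < fst (sketch_of d b xs (i, k))"
    "answer (kcenter_algorithm d b N K) (run (kcenter_algorithm d b N K) xs) k t =
       fst ` set (snd (sketch_of d b xs (j, k)))"
proof -
  let ?f = "\<lambda>i. the (map_of (zip (indices N K) (map (sketch_of d b xs) (indices N K))) (i, k))"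
  have f: "?f i = sketch_of d b xs (i, k)" if "i \<le> N" for i
    using that assms(1,2) by (simp add: map_of_zip_map in_set_indices)
  define j where "j = (LEAST i. fst (?f i) \<le> ereal t)"
  have "fst (?f i) \<le> ereal t" using ex f by simp
  then have j: "j \<le> i" "fst (?f j) \<le> ereal t"
    unfolding j_def by (auto intro: Least_le LeastI)
  have less: "ereal t < fst (?f i')" if "i' < j" for i'
    using not_less_Least[of i' "\<lambda>i. fst (?f i) \<le> ereal t"] that by (auto simp: j_def not_le)
  have fj: "?f i' = sketch_of d b xs (i', k)" if "i' \<le> j" for i'
    using f[of i'] that j ex by simp
  show ?thesis
  proof
    show "fst (sketch_of d b xs (j, k)) \<le> ereal t" using j fj[of j] by simp
    show "ereal t < fst (sketch_of d b xs (i', k))" if "i' < j" for i'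
      using less[OF that] fj[of i'] that by simp
    have "answer (kcenter_algorithm d b N K) (run (kcenter_algorithm d b N K) xs) k t =
        fst ` set (snd (?f j))"
      using assms(1) unfolding j_def run_kcenter_algorithm
      by (simp add: kcenter_algorithm_def decode_encode Let_def)
    then show "answer (kcenter_algorithm d b N K) (run (kcenter_algorithm d b N K) xs) k t =
        fst ` set (snd (sketch_of d b xs (j, k)))" using fj[of j] by simp
  qed
qed

text \<open>Any \<open>q\<close> works, since the only counter ever written is 0. Soundness places
  the stored points and times among those of the stream.\<close>

lemma word_ok_kcenter_algorithm:
  assumes sym: "\<And>x y. d x y = d y x"
    and w: "w \<in> set (run (kcenter_algorithm d b N K) xs)"
  shows "word_ok q xs w"
proof -
  obtain i k where ik: "w \<in> set (encode_sketch (sketch_of d b xs (i, k)))"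
    using w by (auto simp: run_kcenter_algorithm encode_def)
  obtain T L where TL: "sketch_of d b xs (i, k) = (T, L)" by (cases "sketch_of d b xs (i, k)")
  have "sound d (threshold b i) k (set (pairs xs)) (T, L)"
    using sound_foldl_update[of d, OF sym, of "threshold b i" k "pairs xs"] TL by (simp add: sketch_of_def)
  then have "set L \<subseteq> set (pairs xs)" "T = -\<infinity> \<or> T \<in> snd ` set (pairs xs)"
    by (auto simp: sound_def)
  then show ?thesis using ik unfolding TL by (fastforce simp: encode_sketch_def split: if_splits)
qed

lemma length_kcenter_algorithm:
  assumes "\<And>x y. d x y = d y x"
  shows "length (run (kcenter_algorithm d b N K) xs) \<le> Suc N * K * (2 * K + 1)"
proof -
  have "length (run (kcenter_algorithm d b N K) xs) \<le>
      length (map (sketch_of d b xs) (indices N K)) * (2 * K + 1)"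
    unfolding run_kcenter_algorithm
  proof (rule length_encode_le)
    fix Q assume "Q \<in> set (map (sketch_of d b xs) (indices N K))"
    then obtain i k where ik: "k \<le> K" "Q = sketch_of d b xs (i, k)"
      by (auto simp: in_set_indices)
    then have "length (snd Q) \<le> k"
      using sound_foldl_update[of d, OF assms] by (simp add: sketch_of_def)
    then show "length (snd Q) \<le> K" using ik by simp
  qed
  then show ?thesis by (simp only: length_map length_indices)
qed

section \<open>The approximation guarantee\<close>

text \<open>Finiteness turns the infimum over centers into a minimum, so some center attains
  it.\<close>

lemma cost_le_ennreal_iff:
  assumes "finite C" "0 \<le> \<rho>"
  shows "cost d X C \<le> ennreal \<rho> \<longleftrightarrow> (\<forall>x\<in>X. \<exists>c\<in>C. d x c \<le> \<rho>)"
proof -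
  have "set_dist d x C \<le> ennreal \<rho> \<longleftrightarrow> (\<exists>c\<in>C. d x c \<le> \<rho>)" for x
  proof (cases "C = {}")
    case False
    then have "set_dist d x C = Min ((\<lambda>c. ennreal (d x c)) ` C)"
      using assms by (simp add: set_dist_def Min_Inf)
    then show ?thesis using assms False by (simp add: Min_le_iff)
  qed (simp add: set_dist_def top_unique)
  then show ?thesis by (simp add: cost_def SUP_le_iff)
qed

context Metric_space
begin

lemma sketch_covers:
  assumes dist: "\<forall>x\<in>M. \<forall>y\<in>M. x \<noteq> y \<longrightarrow> d x y \<in> {1..\<Delta>}"
    and b: "1 \<le> b" "\<Delta> \<le> b ^ N" and k: "1 \<le> k" "k \<le> K"
    and S: "pt ` set xs \<subseteq> M"
    and C: "C = answer (kcenter_algorithm d b (Suc N) K) (run (kcenter_algorithm d b (Suc N) K) xs) k t"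
    and X: "X = pt ` {x \<in> set xs. ereal t < expiry x}"
  shows "C \<subseteq> M \<and> finite C \<and> card C \<le> k"
    and "\<And>C' \<rho>. \<lbrakk>finite C'; C' \<subseteq> M; card C' \<le> k; 0 \<le> \<rho>; \<forall>x\<in>X. \<exists>c\<in>C'. d x c \<le> \<rho>\<rbrakk>
      \<Longrightarrow> \<forall>x\<in>X. \<exists>c\<in>C. d x c \<le> real k * (2 * \<rho> + 2 * b * \<rho>)"
proof -
  let ?S = "set (pairs xs)" and ?Q = "\<lambda>i. sketch_of d b xs (i, k)"
  have sound: "sound d (threshold b i) k ?S (?Q i)" and len: "length (snd (?Q i)) \<le> k" for i
    using sound_foldl_update[of d, OF commute, of "threshold b i" k "pairs xs"]
    by (simp_all add: sketch_of_def)
  have threshold_nonneg: "0 \<le> threshold b i" for i using b by (simp add: threshold_def)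
  have SM: "fst ` ?S \<subseteq> M" using S by auto
  \<comment> \<open>The certificate of a sketch whose time has not passed consists of active points,
    so it bounds the radius of every competitor \<open>C'\<close> from below.\<close>
  have far: "\<exists>x\<in>M. \<exists>y\<in>M. x \<noteq> y \<and> threshold b i < d x y \<and> d x y \<le> 2 * \<rho>"
    if C': "finite C'" "C' \<subseteq> M" "card C' \<le> k" "\<forall>x\<in>X. \<exists>c\<in>C'. d x c \<le> \<rho>"
      and i: "ereal t < fst (?Q i)" for C' \<rho> i
  proof -
    have "fst (?Q i) \<noteq> -\<infinity>" using i by auto
    then obtain W where W: "length W = Suc k" "set W \<subseteq> ?S" "separated d (threshold b i) W"
      "\<forall>b\<in>set W. fst (?Q i) \<le> snd b"
      using sound[of i] by (auto simp: sound_def split: prod.splits)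
    have cov: "\<exists>c\<in>C'. d (fst a) c \<le> \<rho>" if "a \<in> set W" for a
    proof -
      have "ereal t < snd a" using W(4) i that by (meson less_le_trans)
      then have "fst a \<in> X" using W(2) that by (auto simp: X)
      then show ?thesis using C' by blast
    qed
    have "fst ` set W \<subseteq> M" using W(2) SM by blast
    then show ?thesis
      using separated_pigeonhole[OF W(3,1) _ threshold_nonneg C'(1-3) cov] by metis
  qed
  \<comment> \<open>The top threshold is \<open>b ^ N\<close>, at least \<open>\<Delta>\<close>, so
    no two points are separated there. As \<open>k \<ge> 1\<close>, a certificate would contain two
    such points; hence this sketch never overflowed.\<close>
  have "fst (?Q (Suc N)) \<le> ereal t"
  proof (rule ccontr)
    assume "\<not> ?thesis"
    then have top: "ereal t < fst (?Q (Suc N))" by simp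
    then have "fst (?Q (Suc N)) \<noteq> -\<infinity>" by auto
    then obtain W where W: "length W = Suc k" "set W \<subseteq> ?S" "separated d (threshold b (Suc N)) W"
      using sound[of "Suc N"] by (auto simp: sound_def split: prod.splits)
    have "b ^ N < d (fst (W ! 0)) (fst (W ! 1))"
      using sorted_wrt_nth_less[OF W(3), of 0 1] W(1) k by (simp add: threshold_def)
    moreover have "W ! 0 \<in> set W" "W ! 1 \<in> set W" using W(1) k by auto
    then have M: "fst (W ! 0) \<in> M" "fst (W ! 1) \<in> M" using W(2) SM by auto
    moreover have "0 < b ^ N" using b by simp
    ultimately show False using dist b zero[OF M] by fastforce
  qed
  then obtain j where j: "fst (?Q j) \<le> ereal t" "\<And>i. i < j \<Longrightarrow> ereal t < fst (?Q i)"
    "C = fst ` set (snd (?Q j))"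
    using answer_kcenter_algorithm[OF k, of "Suc N" "Suc N" d b xs t] unfolding C by blast
  have sj: "sound d (threshold b j) k ?S (fst (?Q j), snd (?Q j))" using sound by simp
  then have "set (snd (?Q j)) \<subseteq> ?S" unfolding sound_def by blast
  then have "C \<subseteq> M" unfolding j(3) using SM by blast
  moreover have "card C \<le> length (snd (?Q j))"
    unfolding j(3) by (metis card_length length_map list.set_map)
  ultimately show "C \<subseteq> M \<and> finite C \<and> card C \<le> k" using len[of j] by (simp add: j(3))
  fix C' \<rho> assume C': "finite C'" "C' \<subseteq> M" "card C' \<le> k" "0 \<le> \<rho>" "\<forall>x\<in>X. \<exists>c\<in>C'. d x c \<le> \<rho>"
  \<comment> \<open>By minimality of \<open>j\<close>, the scale below is certified. Above scale 1
    the threshold grows by the factor \<open>b\<close>; the jump from scale 0 to scale 1 is paid by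
    the minimum distance, which gives \<open>1 \<le> 2 * \<rho>\<close>.\<close>
  have "threshold b j \<le> 2 * b * \<rho>"
  proof (cases j)
    case 0
    then show ?thesis using b C' by (simp add: threshold_def)
  next
    case (Suc i)
    then obtain x y where xy: "x \<in> M" "y \<in> M" "x \<noteq> y" "threshold b i < d x y" "d x y \<le> 2 * \<rho>"
      using far[OF C'(1-3,5)] j(2)[of i] by blast
    then have "1 \<le> 2 * \<rho>" using dist by force
    show ?thesis
    proof (cases i)
      case 0
      have "1 * 1 \<le> b * (2 * \<rho>)" using b \<open>1 \<le> 2 * \<rho>\<close> by (intro mult_mono) auto
      then show ?thesis using Suc 0 by (simp add: threshold_def)
    next
      case (Suc i')
      have "b * threshold b i \<le> b * (2 * \<rho>)" using xy b by (intro mult_left_mono) auto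
      then show ?thesis using Suc \<open>j = Suc i\<close> by (simp add: threshold_def)
    qed
  qed
  then have le: "real k * (2 * \<rho> + threshold b j) \<le> real k * (2 * \<rho> + 2 * b * \<rho>)"
    by (intro mult_left_mono) auto
  show "\<forall>x\<in>X. \<exists>c\<in>C. d x c \<le> real k * (2 * \<rho> + 2 * b * \<rho>)"
  proof
    fix x assume "x \<in> X"
    then obtain y where y: "y \<in> set xs" "ereal t < expiry y" "x = pt y" by (auto simp: X)
    have "\<exists>b'\<in>set (snd (?Q j)). d (fst (pt y, expiry y)) (fst b') \<le> real k * (2 * \<rho> + threshold b j)"
      by (rule sound_covers[OF sj SM threshold_nonneg C'(1-3) _ j(1)])
        (use C'(5) y in \<open>auto simp: X\<close>)
    then obtain b' where "b' \<in> set (snd (?Q j))" "d x (fst b') \<le> real k * (2 * \<rho> + threshold b j)"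
      using y by auto
    then show "\<exists>c\<in>C. d x c \<le> real k * (2 * \<rho> + 2 * b * \<rho>)"
      using le unfolding j(3) by (meson image_eqI order_trans)
  qed
qed

text \<open>For \<open>k \<ge> 1\<close>, each competitor of finite cost is matched with factor
  \<open>k * (2 + 2 * b)\<close>, at most \<open>6 * k * (1 + \<epsilon>)\<close>. Since the infimum
  in \<open>opt\<close> need not be attained, the factor is moved across it by dividing.\<close>

lemma kcenter_approximation:
  assumes dist: "\<forall>x\<in>M. \<forall>y\<in>M. x \<noteq> y \<longrightarrow> d x y \<in> {1..\<Delta>}"
    and b: "1 \<le> b" "\<Delta> \<le> b ^ N" "b \<le> 1 + \<epsilon>" and k: "k \<le> K"
    and S: "pt ` set xs \<subseteq> M"
    and C: "C = answer (kcenter_algorithm d b (Suc N) K) (run (kcenter_algorithm d b (Suc N) K) xs) k t"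
    and X: "X = pt ` {x \<in> set xs. ereal t < expiry x}"
  shows "C \<subseteq> M \<and> finite C \<and> card C \<le> k"
    and "cost d X C \<le> ennreal ((6 * real k + 2) * (1 + \<epsilon>)) * opt M d k X"
proof -
  define \<alpha> where "\<alpha> = (6 * real k + 2) * (1 + \<epsilon>)"
  have \<alpha>: "0 < \<alpha>" using b unfolding \<alpha>_def by (intro mult_pos_pos) auto
  show C_ok: "C \<subseteq> M \<and> finite C \<and> card C \<le> k"
  proof (cases "k = 0")
    case True
    then show ?thesis by (simp add: C kcenter_algorithm_def)
  next
    case False
    then show ?thesis using sketch_covers(1)[OF dist b(1,2) _ k S C X] by simp
  qed
  have "cost d X C \<le> ennreal \<alpha> * cost d X C'"
    if C': "C' \<subseteq> M" "finite C'" "card C' = k \<or> C' = M \<and> card M < k" for C'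
  proof (cases "k = 0")
    case True
    \<comment> \<open>Both center sets are empty, so a factor of at least 1 suffices.\<close>
    then have "C = C'" using C' C_ok by auto
    moreover have "1 \<le> \<alpha>"
      using b True by (simp add: \<alpha>_def)
    then have "1 * cost d X C' \<le> ennreal \<alpha> * cost d X C'"
      by (intro mult_right_mono) auto
    ultimately show ?thesis by simp
  next
    case False
    show ?thesis
    proof (cases "cost d X C'")
      case (real \<rho>)
      have "\<forall>x\<in>X. \<exists>c\<in>C. d x c \<le> real k * (2 * \<rho> + 2 * b * \<rho>)"
        using False C' real cost_le_ennreal_iff[OF C'(2), of \<rho> d X]
        by (intro sketch_covers(2)[OF dist b(1,2) _ k S C X]) auto
      then have "cost d X C \<le> ennreal (real k * (2 * \<rho> + 2 * b * \<rho>))"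
        using C_ok real b by (subst cost_le_ennreal_iff) auto
      also have "real k * (2 * \<rho> + 2 * b * \<rho>) \<le> \<alpha> * \<rho>"
      proof -
        have "2 + 2 * b \<le> 6 * (1 + \<epsilon>)" using b by simp
        then have "real k * (2 + 2 * b) \<le> real k * (6 * (1 + \<epsilon>))" by (intro mult_left_mono) auto
        also have "\<dots> = 6 * real k * (1 + \<epsilon>)" by simp
        also have "\<dots> \<le> \<alpha>" unfolding \<alpha>_def using b by (intro mult_right_mono) auto
        finally have "real k * (2 + 2 * b) \<le> \<alpha>" .
        then have "real k * (2 + 2 * b) * \<rho> \<le> \<alpha> * \<rho>" using real by (intro mult_right_mono) auto
        then show ?thesis by (simp add: algebra_simps)
      qed
      finally show ?thesis using real \<alpha> by (simp add: ennreal_mult ennreal_leI)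
    next
      case top
      then show ?thesis using \<alpha> by (simp add: ennreal_mult_top)
    qed
  qed
  then have "cost d X C / ennreal \<alpha> \<le> opt M d k X"
    unfolding opt_def using \<alpha> by (intro INF_greatest divide_le_posI_ennreal) auto
  then have "ennreal \<alpha> * (cost d X C / ennreal \<alpha>) \<le> ennreal \<alpha> * opt M d k X"
    by (rule mult_left_mono) simp
  moreover have "ennreal \<alpha> * (cost d X C / ennreal \<alpha>) = cost d X C"
    using \<alpha> mult_divide_eq_ennreal[of "ennreal \<alpha>" "cost d X C"]
    by (simp add: ennreal_times_divide mult.commute[of "ennreal \<alpha>"])
  ultimately show "cost d X C \<le> ennreal ((6 * real k + 2) * (1 + \<epsilon>)) * opt M d k X"
    by (simp add: \<alpha>_def)
qed

end

section \<open>Number of scales and total space\<close>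

text \<open>By concavity: the chord of \<open>log 2\<close> between 1 and 2 takes the value
  \<open>x\<close> at \<open>1 + x\<close>.\<close>

lemma le_log_2_one_plus:
  assumes "0 \<le> x" "x \<le> 1"
  shows "x \<le> log 2 (1 + x)"
  using concave_onD[OF log_concave[of 2], of x 1 2] assms by (simp add: algebra_simps)

text \<open>Changing from base \<open>1 + \<epsilon>\<close> to base 2 costs a factor
  \<open>1 / log 2 (1 + \<epsilon>)\<close>, at most \<open>1 / \<epsilon>\<close> because
  \<open>\<epsilon> \<le> 1\<close>. The additive 1 absorbs rounding up.\<close>

lemma scale_count:
  assumes "0 < \<epsilon>" "\<epsilon> \<le> 1" "1 \<le> \<Delta>"
  defines "N \<equiv> nat \<lceil>log (1 + \<epsilon>) \<Delta>\<rceil>"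
  shows "\<Delta> \<le> (1 + \<epsilon>) ^ N" "real N \<le> log 2 \<Delta> / \<epsilon> + 1"
proof -
  have nonneg: "0 \<le> log (1 + \<epsilon>) \<Delta>" using assms by simp
  have "\<Delta> = (1 + \<epsilon>) powr log (1 + \<epsilon>) \<Delta>" using assms by simp
  also have "\<dots> \<le> (1 + \<epsilon>) powr real N"
    using assms by (intro powr_mono) (auto simp: N_def le_nat_iff)
  also have "\<dots> = (1 + \<epsilon>) ^ N" using assms(1) by (simp add: powr_realpow)
  finally show "\<Delta> \<le> (1 + \<epsilon>) ^ N" .
  have "log (1 + \<epsilon>) \<Delta> = log 2 \<Delta> / log 2 (1 + \<epsilon>)" using assms by (intro log_base_change) auto
  also have "\<dots> \<le> log 2 \<Delta> / \<epsilon>"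
    using assms le_log_2_one_plus[of \<epsilon>] by (intro divide_left_mono) auto
  finally show "real N \<le> log 2 \<Delta> / \<epsilon> + 1" using nonneg unfolding N_def by linarith
qed

text \<open>The scales run from 0 to \<open>Suc N\<close>, each costing at most
  \<open>3 * K ^ 2\<close> words. The 3 scales beyond the logarithmic term contribute
  \<open>9 * K ^ 2\<close>, absorbed by the first argument of the maximum; hence 12 = 9 + 3.\<close>

lemma space_bound_le:
  assumes "0 < \<epsilon>" "1 \<le> \<Delta>" "real N \<le> log 2 \<Delta> / min 1 \<epsilon> + 1"
  shows "real (Suc (Suc N) * K * (2 * K + 1)) \<le> 12 * space_bound K \<epsilon> \<Delta>"
proof -
  define l where "l = log 2 \<Delta> / min 1 \<epsilon>"
  have le: "real (K * (2 * K + 1)) \<le> 3 * real K ^ 2"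
  proof -
    have "K \<le> K * K" by (cases K) auto
    then have "K * (2 * K + 1) \<le> 3 * K ^ 2" by (simp add: power2_eq_square algebra_simps)
    then show ?thesis by (metis of_nat_le_iff of_nat_mult of_nat_numeral of_nat_power)
  qed
  have "real (Suc (Suc N) * K * (2 * K + 1)) = real (Suc (Suc N)) * real (K * (2 * K + 1))"
    by (simp only: of_nat_mult mult.assoc)
  also have "\<dots> \<le> (l + 3) * (3 * real K ^ 2)"
    using le assms by (intro mult_mono) (auto simp: l_def)
  also have "\<dots> = 9 * real K ^ 2 + 3 * (real K ^ 2 * l)" by (simp add: algebra_simps)
  also have "\<dots> \<le> 12 * max (real K ^ 2) (real K ^ 2 * l)" by linarith
  finally show ?thesis by (simp add: space_bound_def l_def)
qed

theorem theorem1p3: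
  "\<exists>(c::real) (q::nat poly). \<forall>(M::'a set) d (\<Delta>::real) (K::nat) (\<epsilon>::real).
     Metric_space M d \<and> 1 \<le> \<Delta> \<and>
     (\<forall>x\<in>M. \<forall>y\<in>M. x \<noteq> y \<longrightarrow> d x y \<in> {1..\<Delta>}) \<and> 0 < \<epsilon> \<longrightarrow>
     (\<exists>A :: 'a streaming_algorithm.
        (\<forall>xs. valid_stream M xs \<longrightarrow>
           real (length (run A xs)) \<le> c * space_bound K \<epsilon> \<Delta> \<and>
           (\<forall>w\<in>set (run A xs). word_ok q xs w)) \<and>
        (\<forall>xs t k. valid_stream M xs \<and> k \<le> K \<longrightarrow>
           (let C = answer A (run A (arrived xs t)) k t in
              C \<subseteq> M \<and> finite C \<and> card C \<le> k \<and>
              cost d (active xs t) C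
                \<le> ennreal ((6 * real k + 2) * (1 + \<epsilon>)) * opt M d k (active xs t))))"
proof (intro exI[of _ "12 :: real"] exI[of _ "0 :: nat poly"] allI impI, elim conjE)
  fix M :: "'a set" and d and \<Delta> \<epsilon> :: real and K :: nat
  assume "Metric_space M d" and \<Delta>: "1 \<le> \<Delta>" and \<epsilon>: "0 < \<epsilon>"
    and dist: "\<forall>x\<in>M. \<forall>y\<in>M. x \<noteq> y \<longrightarrow> d x y \<in> {1..\<Delta>}"
  interpret Metric_space M d by fact
  \<comment> \<open>Capping at \<open>min 1 \<epsilon>\<close> keeps the base at most 2, as the
    scale count requires.\<close>
  define b where "b = 1 + min 1 \<epsilon>"
  define N where "N = nat \<lceil>log b \<Delta>\<rceil>"
  define A where "A = kcenter_algorithm d b (Suc N) K"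
  have b: "1 \<le> b" "b \<le> 1 + \<epsilon>" using \<epsilon> by (auto simp: b_def)
  have N: "\<Delta> \<le> b ^ N" "real N \<le> log 2 \<Delta> / min 1 \<epsilon> + 1"
    using scale_count[of "min 1 \<epsilon>" \<Delta>] \<epsilon> \<Delta> by (auto simp: N_def b_def)
  show "\<exists>A :: 'a streaming_algorithm.
        (\<forall>xs. valid_stream M xs \<longrightarrow>
           real (length (run A xs)) \<le> 12 * space_bound K \<epsilon> \<Delta> \<and>
           (\<forall>w\<in>set (run A xs). word_ok 0 xs w)) \<and>
        (\<forall>xs t k. valid_stream M xs \<and> k \<le> K \<longrightarrow>
           (let C = answer A (run A (arrived xs t)) k t in
              C \<subseteq> M \<and> finite C \<and> card C \<le> k \<and>
              cost d (active xs t) C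
                \<le> ennreal ((6 * real k + 2) * (1 + \<epsilon>)) * opt M d k (active xs t)))"
  proof (rule exI[of _ A], intro conjI allI impI ballI)
    fix xs
    have "real (length (run A xs)) \<le> real (Suc (Suc N) * K * (2 * K + 1))"
      using length_kcenter_algorithm[of d, OF commute] unfolding A_def of_nat_le_iff by blast
    also have "\<dots> \<le> 12 * space_bound K \<epsilon> \<Delta>" using \<epsilon> \<Delta> N(2) by (rule space_bound_le)
    finally show "real (length (run A xs)) \<le> 12 * space_bound K \<epsilon> \<Delta>" .
    show "word_ok 0 xs w" if "w \<in> set (run A xs)" for w
      using word_ok_kcenter_algorithm[of d, OF commute] that unfolding A_def by blast
  next
    fix xs t k assume xs: "valid_stream M xs \<and> k \<le> K"
    have sub: "pt ` set (arrived xs t) \<subseteq> M" using xs by (auto simp: valid_stream_def arrived_def)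
    \<comment> \<open>Among arrived items, active means not expired, so the stored pairs need no
      insertion times.\<close>
    have act: "active xs t = pt ` {x \<in> set (arrived xs t). ereal t < expiry x}"
      by (auto simp: active_def arrived_def)
    show "let C = answer A (run A (arrived xs t)) k t in
        C \<subseteq> M \<and> finite C \<and> card C \<le> k \<and>
        cost d (active xs t) C
          \<le> ennreal ((6 * real k + 2) * (1 + \<epsilon>)) * opt M d k (active xs t)"
      using kcenter_approximation[OF dist b(1) N(1) b(2) conjunct2[OF xs] sub refl act]
      unfolding A_def Let_def by simp
  qed
qed

end
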